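(* Let $V, W, Z$ be Banach spaces and let $U$ be an open subset of $V$. For each $r \in U$ and each $u \in U \setminus \{r\}$, let $\mathcal{M}(u; r) : W \to Z$ be an invertible linear operator. Suppose that for each $r \in U$, for every sequence $(u_i)$ in $U \setminus \{r\}$ converging to $r$ in $V$, and for every sequence $(w_i)$ in $W$, the following implication holds: $$\|u_i - r\|_V \, \mathcal{M}(u_i; r) w_i \to 0 \text{ in } Z \quad \Longrightarrow \quad w_i \to 0 \text{ in } W .$$ Then $\mathcal{M}$ is a deflation operator.
   Context: Definition (deflation operator). Let $V, W, Z$ be Banach spaces, let $U \subset V$ be open, and for each $r \in U$ and $u \in U\setminus\{r\}$ let $\mathcal{M}(u;r): W \to Z$ be an invertible linear operator (a linear bijection). The family $\mathcal{M}$ is called a deflation operator if for every $r \in U$ and every Fréchet differentiable operator $\mathcal{F}: U \to W$ such that $\mathcal{F}(r) = 0$ and the Fréchet derivative $\mathcal{F}'(r): V \to W$ is nonsingular (i.e. an invertible bounded linear operator), one has $$\liminf_{i \to \infty} \|\mathcal{M}(u_i; r)\mathcal{F}(u_i)\|_Z > 0$$ for every sequence $(u_i)$ in $U \setminus \{r\}$ converging to $r$. *)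

theory Defs
  imports "HOL-Analysis.Analysis"
begin

text \<open>
  Invertibility of a linear operator is purely algebraic: neither the operator nor its inverse
  is required to be bounded.
\<close>

definition invertible_linear :: "('a::real_vector \<Rightarrow> 'b::real_vector) \<Rightarrow> bool" where
  "invertible_linear A \<longleftrightarrow> linear A \<and> bij A"

text \<open>
  Between Banach spaces the inverse of a bounded linear bijection is automatically bounded
  (bounded inverse theorem), so boundedness of the inverse is not part of the definition.
\<close>

definition nonsingular :: "('a::banach \<Rightarrow> 'b::banach) \<Rightarrow> bool" where
  "nonsingular A \<longleftrightarrow> bounded_linear A \<and> bij A"

text \<open>
  \<open>M u r\<close> stands for $\mathcal{M}(u;r)$. Functions on \<open>U\<close> are modelled by total functions; values
  outside the domain (for \<open>M\<close>, also those with \<open>u = r\<close>) are irrelevant, and \<open>at r\<close> is unaffected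
  by them because \<open>U\<close> is open. The limit inferior is taken in \<open>ereal\<close>, since the sequence of norms
  may be unbounded.
\<close>

definition deflation_operator ::
    "'v::banach set \<Rightarrow> ('v \<Rightarrow> 'v \<Rightarrow> 'w::banach \<Rightarrow> 'z::banach) \<Rightarrow> bool" where
  "deflation_operator U M \<longleftrightarrow>
     open U \<and>
     (\<forall>r\<in>U. \<forall>u\<in>U - {r}. invertible_linear (M u r)) \<and>
     (\<forall>r\<in>U. \<forall>F :: 'v \<Rightarrow> 'w.
        F differentiable_on U \<longrightarrow> F r = 0 \<longrightarrow> nonsingular (frechet_derivative F (at r)) \<longrightarrow>
        (\<forall>u :: nat \<Rightarrow> 'v. (\<forall>i. u i \<in> U - {r}) \<longrightarrow> u \<longlonglongrightarrow> r \<longrightarrow>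
           liminf (\<lambda>i. ereal (norm (M (u i) r (F (u i))))) > 0))"

end

theory Submission
  imports Defs
begin

text \<open>
  The idea is to apply the hypothesis to the difference quotients $w_i = F(u_i) / \|u_i - r\|$.
  If the limit inferior vanished, then along a subsequence
  $\|u_i - r\| \mathcal{M}(u_i;r) w_i = \mathcal{M}(u_i;r) F(u_i) \to 0$, so $w_i \to 0$.
  But $F'(r)$ is bounded below by the bounded inverse theorem, which keeps $w_i$ away from $0$.
\<close>

text \<open>The Baire category half of the open mapping theorem. Completeness of the codomain makes
  the closed image of some ball contain a ball. Subtracting preimages of points near two points of
  that ball, then rescaling, solves \<open>A x = y\<close> up to relative error 1/2 with a bound
  linear in \<open>norm y\<close>.\<close>

lemma surj_bounded_linear_approx_preimage:
  fixes A :: "'a::real_normed_vector \<Rightarrow> 'b::banach"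
  assumes "bounded_linear A" "surj A"
  obtains K where "K > 0" "\<And>y. \<exists>x. norm x \<le> K * norm y \<and> norm (y - A x) \<le> norm y / 2"
proof -
  interpret A: bounded_linear A by fact
  define C where "C n = closure (A ` cball 0 (real n))" for n
  have "(\<Union>n. C n) = UNIV"
  proof -
    have "y \<in> (\<Union>n. C n)" for y
    proof -
      obtain x where x: "y = A x" using assms(2) by blast
      obtain n where "norm x \<le> real n" using real_arch_simple by blast
      then have "y \<in> A ` cball 0 (real n)" using x by auto
      then have "y \<in> C n" unfolding C_def by (rule subsetD[OF closure_subset])
      then show ?thesis by blast
    qed
    then show ?thesis by blast
  qed
  moreover have "\<exists>n. interior (C n) \<noteq> {}"
  proof (rule ccontr)
    assume "\<not> ?thesis"
    \<comment> \<open>Baire: a countable union of closed sets with empty interior has empty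
      interior, but here the union is the whole space.\<close>
    then have "euclidean interior_of \<Union>(range C) = {}"
      by (intro Met_TC.metric_Baire_category_alt[unfolded mtopology_is_euclidean])
         (auto simp: complete_UNIV C_def)
    with \<open>(\<Union>n. C n) = UNIV\<close> show False by simp
  qed
  then obtain n y0 where "y0 \<in> interior (C n)" by blast
  then obtain e where "e > 0" and e: "ball y0 e \<subseteq> C n"
    by (meson mem_interior)
  \<comment> \<open>The tolerance e/8 is chosen so that two such errors add up to e/4, half the
    length e/2 to which \<open>y\<close> is scaled below.\<close>
  have near: "\<exists>x. norm x \<le> real n \<and> norm (z - A x) < e / 8" if "z \<in> ball y0 e" for z
  proof -
    have "z \<in> closure (A ` cball 0 (real n))" using e that unfolding C_def by blast
    moreover have "e / 8 > 0" using \<open>e > 0\<close> by simp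
    ultimately obtain a where "a \<in> A ` cball 0 (real n)" "dist a z < e / 8"
      by (meson closure_approachable)
    then show ?thesis by (auto simp: dist_norm norm_minus_commute)
  qed
  \<comment> \<open>The quotient is the bound 2n/t for \<open>x\<close>, with \<open>t\<close> as
    chosen below, divided by \<open>norm y\<close>; the summand 1 keeps \<open>K\<close> positive
    even if \<open>n = 0\<close>.\<close>
  define K where "K = 4 * real n / e + 1"
  show ?thesis
  proof
    show "K > 0" using \<open>e > 0\<close> by (simp add: K_def add_nonneg_pos)
  next
    fix y :: 'b
    show "\<exists>x. norm x \<le> K * norm y \<and> norm (y - A x) \<le> norm y / 2"
    proof (cases "y = 0")
      case True
      then show ?thesis by (intro exI[of _ 0]) (simp add: A.zero)
    next
      case False
      \<comment> \<open>Scaling \<open>y\<close> to length e/2 keeps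
        \<open>y0 + t *\<^sub>R y\<close> inside the ball around \<open>y0\<close>.\<close>
      define t where "t = e / (2 * norm y)"
      have t: "t > 0" "t * norm y = e / 2" using \<open>e > 0\<close> False by (auto simp: t_def)
      obtain x1 where x1: "norm x1 \<le> real n" "norm ((y0 + t *\<^sub>R y) - A x1) < e / 8"
        using near[of "y0 + t *\<^sub>R y"] t \<open>e > 0\<close> by (auto simp: dist_norm)
      obtain x2 where x2: "norm x2 \<le> real n" "norm (y0 - A x2) < e / 8"
        using near[of y0] \<open>e > 0\<close> by auto
      define x where "x = (1 / t) *\<^sub>R (x1 - x2)"
      have "norm (x1 - x2) \<le> 2 * real n"
        using norm_triangle_ineq4[of x1 x2] x1 x2 by linarith
      then have "norm x \<le> (2 * real n) / t"
        using t by (simp add: x_def divide_right_mono)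
      also have "\<dots> = (4 * real n / e) * norm y"
        using \<open>e > 0\<close> False by (simp add: t_def)
      also have "\<dots> \<le> K * norm y" by (simp add: K_def algebra_simps)
      finally have "norm x \<le> K * norm y" .
      moreover have "norm (y - A x) \<le> norm y / 2"
      proof -
        \<comment> \<open>The unknown centre \<open>y0\<close> cancels, leaving only the two
          approximation errors.\<close>
        have "t *\<^sub>R (y - A x) = ((y0 + t *\<^sub>R y) - A x1) - (y0 - A x2)"
          using t by (simp add: x_def A.scaleR A.diff scaleR_diff_right)
        then have "t * norm (y - A x) = norm (((y0 + t *\<^sub>R y) - A x1) - (y0 - A x2))"
          using t by (metis abs_of_pos norm_scaleR)
        also have "\<dots> \<le> e / 4"
          using norm_triangle_ineq4[of "(y0 + t *\<^sub>R y) - A x1" "y0 - A x2"] x1 x2 by linarith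
        also have "\<dots> = t * (norm y / 2)" using t by simp
        finally show ?thesis using t by (simp only: mult_le_cancel_left_pos)
      qed
      ultimately show ?thesis by blast
    qed
  qed
qed

text \<open>Successive approximation: solve approximately, then again for the remaining error. The
  errors halve each time, so the corrections are dominated by a geometric series of sum
  \<open>2 * K * norm y\<close>, and completeness of the domain lets them be summed to an exact
  preimage.\<close>

lemma surj_bounded_linear_bounded_preimage:
  fixes A :: "'a::banach \<Rightarrow> 'b::banach"
  assumes "bounded_linear A" "surj A"
  obtains K where "K > 0" "\<And>y. \<exists>x. A x = y \<and> norm x \<le> K * norm y"
proof -
  interpret A: bounded_linear A by fact
  obtain K where "K > 0"
    and "\<And>y. \<exists>x. norm x \<le> K * norm y \<and> norm (y - A x) \<le> norm y / 2"
    using surj_bounded_linear_approx_preimage[OF assms] by blast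
  then obtain g where g: "\<And>y. norm (g y) \<le> K * norm y" "\<And>y. norm (y - A (g y)) \<le> norm y / 2"
    by metis
  have "\<exists>x. A x = y \<and> norm x \<le> (2 * K) * norm y" for y
  proof -
    \<comment> \<open>\<open>res k\<close> is the error left after \<open>k\<close> corrections; the
      choice function \<open>g\<close> need not be linear.\<close>
    define res where "res k = ((\<lambda>z. z - A (g z)) ^^ k) y" for k
    have res_Suc: "res (Suc k) = res k - A (g (res k))" for k by (simp add: res_def)
    have res: "norm (res k) \<le> norm y * (1/2) ^ k" for k
    proof (induction k)
      case 0
      then show ?case by (simp add: res_def)
    next
      case (Suc k)
      then show ?case using g(2)[of "res k"] by (simp add: res_Suc)
    qed
    define h where "h k = K * norm y * (1/2) ^ k" for k :: nat
    have h: "h sums (2 * K * norm y)"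
      using sums_mult[OF geometric_sums[of "1/2::real"], of "K * norm y"]
      by (simp add: h_def[abs_def] mult_ac)
    have le: "norm (g (res k)) \<le> h k" for k
      using order_trans[OF g(1)[of "res k"] mult_left_mono[OF res[of k], of K]] \<open>K > 0\<close>
      by (simp add: h_def mult.assoc)
    have sn: "summable (\<lambda>k. norm (g (res k)))"
      using le by (intro summable_comparison_test'[OF sums_summable[OF h], of 0]) simp
    then have s: "summable (\<lambda>k. g (res k))" by (rule summable_norm_cancel)
    define x where "x = (\<Sum>k. g (res k))"
    have "norm x \<le> (\<Sum>k. norm (g (res k)))" unfolding x_def by (rule summable_norm[OF sn])
    also have "\<dots> \<le> 2 * K * norm y" using suminf_le[OF le sn] h by (simp add: sums_iff)
    finally have "norm x \<le> 2 * K * norm y" .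
    moreover have "A x = y"
    proof -
      have "(\<lambda>k. A (g (res k))) sums A x"
        unfolding x_def by (intro A.sums summable_sums s)
      \<comment> \<open>The sum telescopes, since each term is \<open>res k - res (Suc k)\<close>
        and \<open>res 0 = y\<close>.\<close>
      moreover have "(\<Sum>k<n. A (g (res k))) = y - res n" for n
        by (induction n) (simp_all add: res_Suc, simp add: res_def)
      moreover have "res \<longlonglongrightarrow> 0"
      proof (rule Lim_null_comparison)
        show "\<forall>\<^sub>F n in sequentially. norm (res n) \<le> norm y * (1/2) ^ n"
          using res by simp
        show "(\<lambda>n. norm y * (1/2) ^ n) \<longlonglongrightarrow> 0"
          by (intro tendsto_mult_right_zero LIMSEQ_realpow_zero) auto
      qed
      then have "(\<lambda>n. y - res n) \<longlonglongrightarrow> y - 0" by (intro tendsto_intros)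
      ultimately show ?thesis
        unfolding sums_def by (simp add: LIMSEQ_unique)
    qed
    ultimately show ?thesis by blast
  qed
  with \<open>K > 0\<close> that[of "2 * K"] show thesis by simp
qed

text \<open>By injectivity the controlled preimage of \<open>A x\<close> can only be
  \<open>x\<close> itself, so \<open>c = 1 / K\<close> works.\<close>

corollary nonsingular_bounded_below:
  assumes "nonsingular A"
  obtains c where "c > 0" "\<And>x. c * norm x \<le> norm (A x)"
proof -
  have A: "bounded_linear A" "surj A" "inj A"
    using assms by (auto simp: nonsingular_def bij_def)
  obtain K where "K > 0" and K: "\<And>y. \<exists>x. A x = y \<and> norm x \<le> K * norm y"
    using surj_bounded_linear_bounded_preimage[OF A(1,2)] by blast
  have "norm x \<le> K * norm (A x)" for x
    using K[of "A x"] A(3) by (metis injD)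
  then show thesis
    using \<open>K > 0\<close> by (intro that[of "1 / K"]) (auto simp: field_simps)
qed

text \<open>Close to \<open>r\<close> the linearization error is at most half of the lower bound for
  \<open>A\<close>, so the other half survives for \<open>F\<close>.\<close>

lemma nonsingular_derivative_eventually_lower_bound:
  assumes "(F has_derivative A) (at r)" "nonsingular A"
  obtains c where "c > 0" "\<forall>\<^sub>F x in at r. c * norm (x - r) \<le> norm (F x - F r)"
proof -
  obtain c where "c > 0" and c: "\<And>x. c * norm x \<le> norm (A x)"
    using nonsingular_bounded_below[OF assms(2)] by blast
  then obtain d where "d > 0" and
    d: "\<And>x. norm (x - r) < d \<Longrightarrow> norm (F x - F r - A (x - r)) \<le> c / 2 * norm (x - r)"
    using assms(1) unfolding has_derivative_at_alt by (meson half_gt_zero)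
  have "c / 2 * norm (x - r) \<le> norm (F x - F r)" if "dist x r < d" for x
  proof -
    have "norm (A (x - r)) \<le> norm (F x - F r) + norm (F x - F r - A (x - r))"
      using norm_triangle_ineq4[of "F x - F r" "F x - F r - A (x - r)"] by simp
    with d[of x] c[of "x - r"] that show ?thesis by (simp add: dist_norm)
  qed
  then have "\<forall>\<^sub>F x in at r. c / 2 * norm (x - r) \<le> norm (F x - F r)"
    using \<open>d > 0\<close> by (auto simp: eventually_at)
  with \<open>c > 0\<close> show thesis by (intro that[of "c / 2"]) auto
qed

theorem lemma2p2:
  fixes U :: "'v::banach set"
    and M :: "'v \<Rightarrow> 'v \<Rightarrow> 'w::banach \<Rightarrow> 'z::banach"
  assumes "open U"
    and "\<And>r u. r \<in> U \<Longrightarrow> u \<in> U - {r} \<Longrightarrow> invertible_linear (M u r)"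
    and "\<And>r (u :: nat \<Rightarrow> 'v) (w :: nat \<Rightarrow> 'w).
           r \<in> U \<Longrightarrow> (\<And>i. u i \<in> U - {r}) \<Longrightarrow> u \<longlonglongrightarrow> r \<Longrightarrow>
           (\<lambda>i. norm (u i - r) *\<^sub>R M (u i) r (w i)) \<longlonglongrightarrow> 0 \<Longrightarrow> w \<longlonglongrightarrow> 0"
  shows "deflation_operator U M"
  unfolding deflation_operator_def
proof (intro conjI ballI allI impI)
  show "open U" by fact
next
  fix r u assume "r \<in> U" "u \<in> U - {r}"
  then show "invertible_linear (M u r)" by (rule assms(2))
next
  fix r and F :: "'v \<Rightarrow> 'w" and u :: "nat \<Rightarrow> 'v"
  assume "r \<in> U" and F: "F differentiable_on U" "F r = 0"
    and ns: "nonsingular (frechet_derivative F (at r))"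
    and u: "\<forall>i. u i \<in> U - {r}" "u \<longlonglongrightarrow> r"
  let ?m = "\<lambda>i. ereal (norm (M (u i) r (F (u i))))"
  show "liminf ?m > 0"
  proof (rule ccontr)
    assume "\<not> liminf ?m > 0"
    moreover have "liminf ?m \<ge> 0" by (intro Liminf_bounded) simp
    ultimately have "liminf ?m = 0" by simp
    \<comment> \<open>Some subsequence realizes the limit inferior as a genuine limit, and the
      hypothesis on \<open>M\<close> applies to it as well.\<close>
    then obtain s where s: "strict_mono s" "(?m \<circ> s) \<longlonglongrightarrow> 0"
      using liminf_subseq_lim[of ?m] by auto
    define v where "v = u \<circ> s"
    have v: "v i \<in> U - {r}" for i using u(1) by (simp add: v_def)
    have v_lim: "v \<longlonglongrightarrow> r" unfolding v_def by (rule LIMSEQ_subseq_LIMSEQ[OF u(2) s(1)])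
    have Mv: "(\<lambda>i. M (v i) r (F (v i))) \<longlonglongrightarrow> 0"
    proof (rule tendsto_norm_zero_cancel)
      have "(\<lambda>i. ereal (norm (M (v i) r (F (v i))))) \<longlonglongrightarrow> ereal 0"
        using s(2) by (simp add: v_def o_def zero_ereal_def)
      then show "(\<lambda>i. norm (M (v i) r (F (v i)))) \<longlonglongrightarrow> 0" by (simp only: lim_ereal)
    qed
    \<comment> \<open>Dividing by the distance makes the weight in the hypothesis cancel by
      linearity of \<open>M (v i) r\<close>; the division is legitimate because \<open>v i\<close>
      differs from \<open>r\<close>.\<close>
    define w where "w i = F (v i) /\<^sub>R norm (v i - r)" for i
    have "norm (v i - r) *\<^sub>R M (v i) r (w i) = M (v i) r (F (v i))" for i
    proof -
      have "linear (M (v i) r)"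
        using assms(2)[OF \<open>r \<in> U\<close> v] by (simp add: invertible_linear_def)
      then show ?thesis using v[of i] by (simp add: w_def linear_scale)
    qed
    with Mv have "w \<longlonglongrightarrow> 0"
      by (intro assms(3)[OF \<open>r \<in> U\<close> v v_lim]) simp
    have "(F has_derivative frechet_derivative F (at r)) (at r)"
      using F(1) \<open>open U\<close> \<open>r \<in> U\<close>
      by (simp add: differentiable_on_eq_differentiable_at frechet_derivative_works)
    then obtain c where "c > 0" and c: "\<forall>\<^sub>F x in at r. c * norm (x - r) \<le> norm (F x - F r)"
      using nonsingular_derivative_eventually_lower_bound ns by blast
    \<comment> \<open>Because \<open>v\<close> avoids \<open>r\<close>, it converges in the
      punctured sense, so the bound near \<open>r\<close> can be pulled back along it.\<close>
    have "filterlim v (at r) sequentially"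
      using v v_lim by (auto simp: filterlim_at)
    from eventually_compose_filterlim[OF c this]
    \<comment> \<open>With \<open>F r = 0\<close>, dividing the pulled-back bound by
      \<open>norm (v i - r)\<close> bounds \<open>w\<close> away from 0.\<close>
    have "\<forall>\<^sub>F i in sequentially. c \<le> norm (w i)"
      by eventually_elim (use v F(2) in \<open>auto simp: w_def field_simps\<close>)
    moreover have "\<forall>\<^sub>F i in sequentially. norm (w i) < c"
      using \<open>w \<longlonglongrightarrow> 0\<close> \<open>c > 0\<close> by (auto simp: tendsto_iff)
    ultimately have "\<forall>\<^sub>F i in sequentially. False" by eventually_elim simp
    then show False by simp
  qed
qed

end
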